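(* Let $(G,m,u,\iota)$ be a group object in a Cartesian tangent category such that the pullback $T(G)_u$ of $p_G:T(G)\to G$ along $u:1\to G$ exists. Let $\phi=\langle p,\langle !,\langle p\iota0,1\rangle T(m)\rangle\rangle:T(G)\to G\times T(G)_u$, an isomorphism with inverse $\phi^{-1}=(0\times p_u^* )T(m)$. Then $$\phi^{-1}\,T(\iota)\,\phi=\langle\pi_0\iota,\ \mathrm{Ad}_\ell\,T(\iota)_u\rangle:G\times T(G)_u\to G\times T(G)_u.$$
   Context: Composition is written in diagrammatic order: $fg$ means first $f$, then $g$. Tangent category $(\mathbb X,T,p,0,+,\ell,c)$: a category $\mathbb X$ with a functor $T:\mathbb X\to\mathbb X$ and a natural transformation $p:T\to 1$ such that the pullback powers $T_n(M)$ of $p_M$ ($n$-fold fibre products of $T(M)$ over $M$) exist for all objects $M$ and are preserved by $T$; natural transformations $+:T_2\to T$, $0:1\to T$ making each $p_M$ an additive bundle (a commutative monoid over $M$: $+p=\pi_0p=\pi_1p$, $0p=1$, $+$ associative, commutative, with unit $0$); a natural transformation $\ell:T\to T^2$ such that $(\ell_M,0_M):(p_M,+_M,0_M)\to(T(p_M),T(+_M),T(0_M))$ is an additive bundle morphism (commutes with projections, additions and zeros); a natural transformation $c:T^2\to T^2$ with $c^2=1$, $\ell c=\ell$ such that $(c_M,1):(T(p_M),T(+_M),T(0_M))\to(p_{TM},+_{TM},0_{TM})$ is an additive bundle morphism; such that $\ell T(\ell)=\ell\,\ell_T$, $T(c)\,c_T\,T(c)=c_T\,T(c)\,c_T$, $\ell_T\,T(c)\,c_T=c\,T(\ell)$,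 and $\langle\pi_0\ell,\pi_1 0_T\rangle T(+):T_2M\to T^2M$ is the equalizer of $T(p)$ and $T(p)p0:T^2M\to TM$. Cartesian tangent category: a tangent category with all finite products (terminal object $1$) such that the product functor, with the natural isomorphism $T(A)\times T(B)\cong T(A\times B)$, is a strong morphism of tangent categories (the canonical comparison maps are isomorphisms compatible with $p,0,+,\ell,c$). These identifications are suppressed, so e.g. $T(m):T(G)\times T(G)\to T(G)$. $!$ is the unique map to $1$; $f\times g=\langle\pi_0f,\pi_1g\rangle$; $p_u^*:T(G)_u\to T(G)$ is the pullback projection; for $h:X\to T(G)$ with $hp=!u$, $\langle !,h\rangle:X\to T(G)_u$ is the unique map with $\langle !,h\rangle p_u^*=h$. $m_3=(m\times1)m:G\times G\times G\to G$. The adjoint left action is $\mathrm{Ad}_\ell=\langle !,\langle\pi_00,\pi_1p_u^*,\pi_0\iota0\rangle T(m_3)\rangle:G\times T(G)_u\to T(G)_u$. $T(\iota)_u:T(G)_u\to T(G)_u$ is the unique map with $T(\iota)_up_u^*=p_u^*T(\iota)$. *)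

theory Defs
  imports Main
begin

text \<open>
  Composition is written in diagrammatic order throughout: \<open>f \<cdot> g\<close> is first \<open>f\<close>, then \<open>g\<close>.
\<close>

section \<open>Categories, limits, natural transformations\<close>

record ('o, 'a) category =
  Ob   :: "'o set"
  Arr  :: "'a set"
  Dom  :: "'a \<Rightarrow> 'o"
  Cod  :: "'a \<Rightarrow> 'o"
  Idt  :: "'o \<Rightarrow> 'a"
  Comp :: "'a \<Rightarrow> 'a \<Rightarrow> 'a"  (infixl "\<cdot>\<index>" 70)

definition Hom :: "('o, 'a, 'z) category_scheme \<Rightarrow> 'o \<Rightarrow> 'o \<Rightarrow> 'a set" ("Hom\<index>") where
  "Hom\<^bsub>C\<^esub> A B = {f \<in> Arr C. Dom C f = A \<and> Cod C f = B}"

locale category =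
  fixes C :: "('o, 'a, 'z) category_scheme" (structure)
  assumes Dom_Ob: "f \<in> Arr C \<Longrightarrow> Dom C f \<in> Ob C"
    and Cod_Ob: "f \<in> Arr C \<Longrightarrow> Cod C f \<in> Ob C"
    and Idt_Hom: "A \<in> Ob C \<Longrightarrow> Idt C A \<in> Hom A A"
    and Comp_Hom: "\<lbrakk>f \<in> Hom A B; g \<in> Hom B D\<rbrakk> \<Longrightarrow> f \<cdot> g \<in> Hom A D"
    and Idt_Comp: "f \<in> Hom A B \<Longrightarrow> Idt C A \<cdot> f = f"
    and Comp_Idt: "f \<in> Hom A B \<Longrightarrow> f \<cdot> Idt C B = f"
    and Comp_assoc:
      "\<lbrakk>f \<in> Hom A B; g \<in> Hom B D; h \<in> Hom D E\<rbrakk> \<Longrightarrow> (f \<cdot> g) \<cdot> h = f \<cdot> (g \<cdot> h)"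

context
  fixes C :: "('o, 'a, 'z) category_scheme" (structure)
begin

definition inverse_arrows :: "'a \<Rightarrow> 'a \<Rightarrow> bool" where
  "inverse_arrows f g \<longleftrightarrow>
     f \<in> Arr C \<and> g \<in> Hom (Cod C f) (Dom C f) \<and>
     f \<cdot> g = Idt C (Dom C f) \<and> g \<cdot> f = Idt C (Cod C f)"

definition is_iso :: "'a \<Rightarrow> bool" where
  "is_iso f \<longleftrightarrow> (\<exists>g. inverse_arrows f g)"

definition inv_arr :: "'a \<Rightarrow> 'a" where
  "inv_arr f = (THE g. inverse_arrows f g)"

definition is_terminal :: "'o \<Rightarrow> bool" where
  "is_terminal I \<longleftrightarrow> I \<in> Ob C \<and> (\<forall>A\<in>Ob C. \<exists>!f. f \<in> Hom A I)"

definition is_product :: "'o \<Rightarrow> 'a \<Rightarrow> 'a \<Rightarrow> 'o \<Rightarrow> 'o \<Rightarrow> bool" where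
  "is_product P a b A B \<longleftrightarrow>
     a \<in> Hom P A \<and> b \<in> Hom P B \<and>
     (\<forall>X. \<forall>h\<in>Hom X A. \<forall>k\<in>Hom X B. \<exists>!w. w \<in> Hom X P \<and> w \<cdot> a = h \<and> w \<cdot> b = k)"

definition is_pullback :: "'o \<Rightarrow> 'a \<Rightarrow> 'a \<Rightarrow> 'a \<Rightarrow> 'a \<Rightarrow> bool" where
  "is_pullback P a b f g \<longleftrightarrow>
     f \<in> Arr C \<and> g \<in> Arr C \<and> Cod C f = Cod C g \<and>
     a \<in> Hom P (Dom C f) \<and> b \<in> Hom P (Dom C g) \<and> a \<cdot> f = b \<cdot> g \<and>
     (\<forall>X. \<forall>h\<in>Hom X (Dom C f). \<forall>k\<in>Hom X (Dom C g). h \<cdot> f = k \<cdot> g \<longrightarrow>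
        (\<exists>!w. w \<in> Hom X P \<and> w \<cdot> a = h \<and> w \<cdot> b = k))"

text \<open>The map \<open>\<langle>h, k\<rangle>\<close> into a product or pullback \<open>P\<close> with projections \<open>a\<close>, \<open>b\<close>.\<close>

definition mediating :: "'o \<Rightarrow> 'a \<Rightarrow> 'a \<Rightarrow> 'a \<Rightarrow> 'a \<Rightarrow> 'a" where
  "mediating P a b h k = (THE w. w \<in> Hom (Dom C h) P \<and> w \<cdot> a = h \<and> w \<cdot> b = k)"

text \<open>
  \<open>n\<close>-fold fibre product of \<open>f : E \<rightarrow> M\<close> over \<open>M\<close>, with projections \<open>\<pi> i\<close> (\<open>i < n\<close>) and
  structure map \<open>q\<close> to \<open>M\<close>.  The latter is redundant for \<open>n > 0\<close>, but for \<open>n = 0\<close> it makes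
  the fibre product \<open>M\<close> itself.
\<close>

definition is_fibre_power :: "nat \<Rightarrow> 'a \<Rightarrow> 'o \<Rightarrow> 'a \<Rightarrow> (nat \<Rightarrow> 'a) \<Rightarrow> bool" where
  "is_fibre_power n f P q \<pi> \<longleftrightarrow>
     f \<in> Arr C \<and> q \<in> Hom P (Cod C f) \<and>
     (\<forall>i<n. \<pi> i \<in> Hom P (Dom C f) \<and> \<pi> i \<cdot> f = q) \<and>
     (\<forall>X h. \<forall>r\<in>Hom X (Cod C f). (\<forall>i<n. h i \<in> Hom X (Dom C f) \<and> h i \<cdot> f = r) \<longrightarrow>
        (\<exists>!w. w \<in> Hom X P \<and> w \<cdot> q = r \<and> (\<forall>i<n. w \<cdot> \<pi> i = h i)))"

definition is_equalizer :: "'a \<Rightarrow> 'a \<Rightarrow> 'a \<Rightarrow> bool" where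
  "is_equalizer e f g \<longleftrightarrow>
     f \<in> Arr C \<and> g \<in> Hom (Dom C f) (Cod C f) \<and> e \<in> Hom (Dom C e) (Dom C f) \<and>
     e \<cdot> f = e \<cdot> g \<and>
     (\<forall>X. \<forall>h\<in>Hom X (Dom C f). h \<cdot> f = h \<cdot> g \<longrightarrow> (\<exists>!w. w \<in> Hom X (Dom C e) \<and> w \<cdot> e = h))"

definition is_endofunctor :: "('o \<Rightarrow> 'o) \<Rightarrow> ('a \<Rightarrow> 'a) \<Rightarrow> bool" where
  "is_endofunctor F F' \<longleftrightarrow>
     (\<forall>A\<in>Ob C. F A \<in> Ob C \<and> F' (Idt C A) = Idt C (F A)) \<and>
     (\<forall>A B. \<forall>f\<in>Hom A B. F' f \<in> Hom (F A) (F B)) \<and>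
     (\<forall>A B D. \<forall>f\<in>Hom A B. \<forall>g\<in>Hom B D. F' (f \<cdot> g) = F' f \<cdot> F' g)"

definition is_natural ::
  "('o \<Rightarrow> 'o) \<Rightarrow> ('a \<Rightarrow> 'a) \<Rightarrow> ('o \<Rightarrow> 'o) \<Rightarrow> ('a \<Rightarrow> 'a) \<Rightarrow> ('o \<Rightarrow> 'a) \<Rightarrow> bool" where
  "is_natural F F' G G' \<eta> \<longleftrightarrow>
     (\<forall>A\<in>Ob C. \<eta> A \<in> Hom (F A) (G A)) \<and>
     (\<forall>A B. \<forall>f\<in>Hom A B. F' f \<cdot> \<eta> B = \<eta> A \<cdot> G' f)"

end


section \<open>Additive bundles\<close>

text \<open>
  A bundle \<open>p : E \<rightarrow> M\<close> with its fibre square \<open>E\<^sub>2\<close>, the two projections \<open>E\<^sub>2 \<rightarrow> E\<close>,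
  an addition \<open>E\<^sub>2 \<rightarrow> E\<close> and a zero \<open>M \<rightarrow> E\<close>.
\<close>

record ('o, 'a) bundle_data =
  bproj  :: 'a
  bpow2  :: 'o
  bpr0   :: 'a
  bpr1   :: 'a
  badd   :: 'a
  bzero  :: 'a

context
  fixes C :: "('o, 'a, 'z) category_scheme" (structure)
begin

definition bpair :: "('o, 'a) bundle_data \<Rightarrow> 'a \<Rightarrow> 'a \<Rightarrow> 'a" where
  "bpair E h k = mediating C (bpow2 E) (bpr0 E) (bpr1 E) h k"

definition additive_bundle :: "('o, 'a) bundle_data \<Rightarrow> bool" where
  "additive_bundle E \<longleftrightarrow>
     is_pullback C (bpow2 E) (bpr0 E) (bpr1 E) (bproj E) (bproj E) \<and>
     badd E \<in> Hom (bpow2 E) (Dom C (bproj E)) \<and>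
     bzero E \<in> Hom (Cod C (bproj E)) (Dom C (bproj E)) \<and>
     badd E \<cdot> bproj E = bpr0 E \<cdot> bproj E \<and>
     badd E \<cdot> bproj E = bpr1 E \<cdot> bproj E \<and>
     bzero E \<cdot> bproj E = Idt C (Cod C (bproj E)) \<and>
     (\<forall>P q \<pi>. is_fibre_power C 3 (bproj E) P q \<pi> \<longrightarrow>
        bpair E (bpair E (\<pi> 0) (\<pi> 1) \<cdot> badd E) (\<pi> 2) \<cdot> badd E =
        bpair E (\<pi> 0) (bpair E (\<pi> 1) (\<pi> 2) \<cdot> badd E) \<cdot> badd E) \<and>
     bpair E (bpr1 E) (bpr0 E) \<cdot> badd E = badd E \<and>
     bpair E (bproj E \<cdot> bzero E) (Idt C (Dom C (bproj E))) \<cdot> badd E = Idt C (Dom C (bproj E)) \<and>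
     bpair E (Idt C (Dom C (bproj E))) (bproj E \<cdot> bzero E) \<cdot> badd E = Idt C (Dom C (bproj E))"

definition additive_bundle_morphism ::
  "('o, 'a) bundle_data \<Rightarrow> ('o, 'a) bundle_data \<Rightarrow> 'a \<Rightarrow> 'a \<Rightarrow> bool" where
  "additive_bundle_morphism E E' f g \<longleftrightarrow>
     f \<in> Hom (Dom C (bproj E)) (Dom C (bproj E')) \<and>
     g \<in> Hom (Cod C (bproj E)) (Cod C (bproj E')) \<and>
     f \<cdot> bproj E' = bproj E \<cdot> g \<and>
     badd E \<cdot> f = bpair E' (bpr0 E \<cdot> f) (bpr1 E \<cdot> f) \<cdot> badd E' \<and>
     bzero E \<cdot> f = g \<cdot> bzero E'"

end


section \<open>Tangent categories\<close>

text \<open>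
  \<open>TO\<close> and \<open>TA\<close> are the object and arrow parts of \<open>T\<close>; \<open>T2 M\<close> with \<open>tpr0 M\<close>, \<open>tpr1 M\<close> is a
  chosen fibre square of \<open>p\<^sub>M\<close>.
\<close>

record ('o, 'a) tangent_category = "('o, 'a) category" +
  TO    :: "'o \<Rightarrow> 'o"
  TA    :: "'a \<Rightarrow> 'a"
  tp    :: "'o \<Rightarrow> 'a"
  T2    :: "'o \<Rightarrow> 'o"
  tpr0  :: "'o \<Rightarrow> 'a"
  tpr1  :: "'o \<Rightarrow> 'a"
  tzero :: "'o \<Rightarrow> 'a"
  tadd  :: "'o \<Rightarrow> 'a"
  tlift :: "'o \<Rightarrow> 'a"
  tflip :: "'o \<Rightarrow> 'a"

context
  fixes C :: "('o, 'a, 'z) tangent_category_scheme" (structure)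
begin

definition tangent_bundle :: "'o \<Rightarrow> ('o, 'a) bundle_data" where
  "tangent_bundle M =
     \<lparr>bproj = tp C M, bpow2 = T2 C M, bpr0 = tpr0 C M, bpr1 = tpr1 C M,
      badd = tadd C M, bzero = tzero C M\<rparr>"

definition T_bundle :: "('o, 'a) bundle_data \<Rightarrow> ('o, 'a) bundle_data" where
  "T_bundle E =
     \<lparr>bproj = TA C (bproj E), bpow2 = TO C (bpow2 E),
      bpr0 = TA C (bpr0 E), bpr1 = TA C (bpr1 E),
      badd = TA C (badd E), bzero = TA C (bzero E)\<rparr>"

definition T2A :: "'a \<Rightarrow> 'a" where
  "T2A f =
     bpair C (tangent_bundle (Cod C f))
       (tpr0 C (Dom C f) \<cdot> TA C f) (tpr1 C (Dom C f) \<cdot> TA C f)"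

end

locale tangent_category = category C
  for C :: "('o, 'a, 'z) tangent_category_scheme" (structure) +
  assumes T_functor: "is_endofunctor C (TO C) (TA C)"
    and p_natural: "is_natural C (TO C) (TA C) (\<lambda>M. M) (\<lambda>f. f) (tp C)"
    and fibre_powers_exist: "M \<in> Ob C \<Longrightarrow> \<exists>P q \<pi>. is_fibre_power C n (tp C M) P q \<pi>"
    and fibre_powers_preserved:
      "\<lbrakk>M \<in> Ob C; is_fibre_power C n (tp C M) P q \<pi>\<rbrakk>
        \<Longrightarrow> is_fibre_power C n (TA C (tp C M)) (TO C P) (TA C q) (\<lambda>i. TA C (\<pi> i))"
    and T2_pullback:
      "M \<in> Ob C \<Longrightarrow> is_pullback C (T2 C M) (tpr0 C M) (tpr1 C M) (tp C M) (tp C M)"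
    and zero_natural: "is_natural C (\<lambda>M. M) (\<lambda>f. f) (TO C) (TA C) (tzero C)"
    and add_natural: "is_natural C (T2 C) (T2A C) (TO C) (TA C) (tadd C)"
    and additive: "M \<in> Ob C \<Longrightarrow> additive_bundle C (tangent_bundle C M)"
    and lift_natural:
      "is_natural C (TO C) (TA C) (\<lambda>M. TO C (TO C M)) (\<lambda>f. TA C (TA C f)) (tlift C)"
    and lift_additive:
      "M \<in> Ob C \<Longrightarrow>
        additive_bundle_morphism C (tangent_bundle C M) (T_bundle C (tangent_bundle C M))
          (tlift C M) (tzero C M)"
    and flip_natural:
      "is_natural C (\<lambda>M. TO C (TO C M)) (\<lambda>f. TA C (TA C f))
         (\<lambda>M. TO C (TO C M)) (\<lambda>f. TA C (TA C f)) (tflip C)"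
    and flip_flip: "M \<in> Ob C \<Longrightarrow> tflip C M \<cdot> tflip C M = Idt C (TO C (TO C M))"
    and lift_flip: "M \<in> Ob C \<Longrightarrow> tlift C M \<cdot> tflip C M = tlift C M"
    and flip_additive:
      "M \<in> Ob C \<Longrightarrow>
        additive_bundle_morphism C (T_bundle C (tangent_bundle C M)) (tangent_bundle C (TO C M))
          (tflip C M) (Idt C (TO C M))"
    and lift_lift:
      "M \<in> Ob C \<Longrightarrow> tlift C M \<cdot> TA C (tlift C M) = tlift C M \<cdot> tlift C (TO C M)"
    and flip_braid:
      "M \<in> Ob C \<Longrightarrow>
        TA C (tflip C M) \<cdot> tflip C (TO C M) \<cdot> TA C (tflip C M) =
        tflip C (TO C M) \<cdot> TA C (tflip C M) \<cdot> tflip C (TO C M)"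
    and lift_flip_flip:
      "M \<in> Ob C \<Longrightarrow>
        tlift C (TO C M) \<cdot> TA C (tflip C M) \<cdot> tflip C (TO C M) =
        tflip C M \<cdot> TA C (tlift C M)"
    and lift_universal:
      "M \<in> Ob C \<Longrightarrow>
        is_equalizer C
          (bpair C (T_bundle C (tangent_bundle C M))
             (tpr0 C M \<cdot> tlift C M) (tpr1 C M \<cdot> tzero C (TO C M)) \<cdot> TA C (tadd C M))
          (TA C (tp C M))
          (TA C (tp C M) \<cdot> tp C M \<cdot> tzero C M)"


section \<open>Cartesian tangent categories\<close>

record ('o, 'a) cartesian_tangent_category = "('o, 'a) tangent_category" +
  One  :: 'o
  Prd  :: "'o \<Rightarrow> 'o \<Rightarrow> 'o"
  prj0 :: "'o \<Rightarrow> 'o \<Rightarrow> 'a"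
  prj1 :: "'o \<Rightarrow> 'o \<Rightarrow> 'a"

definition bang :: "('o, 'a, 'z) cartesian_tangent_category_scheme \<Rightarrow> 'o \<Rightarrow> 'a" where
  "bang C A = (THE f. f \<in> Hom\<^bsub>C\<^esub> A (One C))"

definition pair ::
  "('o, 'a, 'z) cartesian_tangent_category_scheme \<Rightarrow> 'a \<Rightarrow> 'a \<Rightarrow> 'a"  ("\<langle>_,/ _\<rangle>\<index>") where
  "\<langle>f, g\<rangle>\<^bsub>C\<^esub> =
     mediating C (Prd C (Cod C f) (Cod C g))
       (prj0 C (Cod C f) (Cod C g)) (prj1 C (Cod C f) (Cod C g)) f g"

definition prod_map ::
  "('o, 'a, 'z) cartesian_tangent_category_scheme \<Rightarrow> 'a \<Rightarrow> 'a \<Rightarrow> 'a"  (infixr "\<otimes>\<index>" 75) where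
  "f \<otimes>\<^bsub>C\<^esub> g =
     \<langle>prj0 C (Dom C f) (Dom C g) \<cdot>\<^bsub>C\<^esub> f, prj1 C (Dom C f) (Dom C g) \<cdot>\<^bsub>C\<^esub> g\<rangle>\<^bsub>C\<^esub>"

text \<open>The canonical comparison \<open>T(A \<times> B) \<rightarrow> T(A) \<times> T(B)\<close> and its analogue for \<open>T\<^sub>2\<close>.\<close>

definition Tcomp ::
  "('o, 'a, 'z) cartesian_tangent_category_scheme \<Rightarrow> 'o \<Rightarrow> 'o \<Rightarrow> 'a" where
  "Tcomp C A B = \<langle>TA C (prj0 C A B), TA C (prj1 C A B)\<rangle>\<^bsub>C\<^esub>"

definition T2comp ::
  "('o, 'a, 'z) cartesian_tangent_category_scheme \<Rightarrow> 'o \<Rightarrow> 'o \<Rightarrow> 'a" where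
  "T2comp C A B = \<langle>T2A C (prj0 C A B), T2A C (prj1 C A B)\<rangle>\<^bsub>C\<^esub>"

text \<open>
  For the terminal object only invertibility of the comparison \<open>T(1) \<rightarrow> 1\<close> is required: the
  compatibilities with the tangent structure are equations between maps into \<open>1\<close>.
\<close>

locale cartesian_tangent_category = tangent_category C
  for C :: "('o, 'a, 'z) cartesian_tangent_category_scheme" (structure) +
  assumes One_terminal: "is_terminal C (One C)"
    and Prd_product:
      "\<lbrakk>A \<in> Ob C; B \<in> Ob C\<rbrakk> \<Longrightarrow> is_product C (Prd C A B) (prj0 C A B) (prj1 C A B) A B"
    and T_One_iso: "is_iso C (bang C (TO C (One C)))"
    and Tcomp_iso: "\<lbrakk>A \<in> Ob C; B \<in> Ob C\<rbrakk> \<Longrightarrow> is_iso C (Tcomp C A B)"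
    and Tcomp_natural:
      "\<lbrakk>f \<in> Hom A A'; g \<in> Hom B B'\<rbrakk>
        \<Longrightarrow> TA C (f \<otimes> g) \<cdot> Tcomp C A' B' = Tcomp C A B \<cdot> (TA C f \<otimes> TA C g)"
    and Tcomp_p:
      "\<lbrakk>A \<in> Ob C; B \<in> Ob C\<rbrakk> \<Longrightarrow> tp C (Prd C A B) = Tcomp C A B \<cdot> (tp C A \<otimes> tp C B)"
    and Tcomp_zero:
      "\<lbrakk>A \<in> Ob C; B \<in> Ob C\<rbrakk>
        \<Longrightarrow> tzero C (Prd C A B) \<cdot> Tcomp C A B = tzero C A \<otimes> tzero C B"
    and Tcomp_add:
      "\<lbrakk>A \<in> Ob C; B \<in> Ob C\<rbrakk>
        \<Longrightarrow> tadd C (Prd C A B) \<cdot> Tcomp C A B = T2comp C A B \<cdot> (tadd C A \<otimes> tadd C B)"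
    and Tcomp_lift:
      "\<lbrakk>A \<in> Ob C; B \<in> Ob C\<rbrakk>
        \<Longrightarrow> tlift C (Prd C A B) \<cdot> (TA C (Tcomp C A B) \<cdot> Tcomp C (TO C A) (TO C B)) =
            Tcomp C A B \<cdot> (tlift C A \<otimes> tlift C B)"
    and Tcomp_flip:
      "\<lbrakk>A \<in> Ob C; B \<in> Ob C\<rbrakk>
        \<Longrightarrow> tflip C (Prd C A B) \<cdot> (TA C (Tcomp C A B) \<cdot> Tcomp C (TO C A) (TO C B)) =
            TA C (Tcomp C A B) \<cdot> Tcomp C (TO C A) (TO C B) \<cdot> (tflip C A \<otimes> tflip C B)"


section \<open>Group objects and the left trivialisation of the tangent bundle\<close>

context
  fixes C :: "('o, 'a, 'z) cartesian_tangent_category_scheme" (structure)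
begin

definition assoc_map :: "'o \<Rightarrow> 'o \<Rightarrow> 'o \<Rightarrow> 'a" where
  "assoc_map A B D =
     \<langle>prj0 C (Prd C A B) D \<cdot> prj0 C A B,
      \<langle>prj0 C (Prd C A B) D \<cdot> prj1 C A B, prj1 C (Prd C A B) D\<rangle>\<rangle>"

definition group_object :: "'o \<Rightarrow> 'a \<Rightarrow> 'a \<Rightarrow> 'a \<Rightarrow> bool" where
  "group_object G m u \<iota> \<longleftrightarrow>
     G \<in> Ob C \<and> m \<in> Hom (Prd C G G) G \<and> u \<in> Hom (One C) G \<and> \<iota> \<in> Hom G G \<and>
     (m \<otimes> Idt C G) \<cdot> m = assoc_map G G G \<cdot> (Idt C G \<otimes> m) \<cdot> m \<and>
     \<langle>Idt C G, bang C G \<cdot> u\<rangle> \<cdot> m = Idt C G \<and>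
     \<langle>bang C G \<cdot> u, Idt C G\<rangle> \<cdot> m = Idt C G \<and>
     \<langle>Idt C G, \<iota>\<rangle> \<cdot> m = bang C G \<cdot> u \<and>
     \<langle>\<iota>, Idt C G\<rangle> \<cdot> m = bang C G \<cdot> u"

text \<open>
  \<open>T(f)\<close> read as a map on \<open>T(A) \<times> T(B)\<close>, resp. \<open>(T(A) \<times> T(B)) \<times> T(D)\<close>, for
  \<open>f\<close> with domain \<open>A \<times> B\<close>, resp. \<open>(A \<times> B) \<times> D\<close>.
\<close>

definition T_on_prod :: "'o \<Rightarrow> 'o \<Rightarrow> 'a \<Rightarrow> 'a" where
  "T_on_prod A B f = inv_arr C (Tcomp C A B) \<cdot> TA C f"

definition T_on_prod3 :: "'o \<Rightarrow> 'o \<Rightarrow> 'o \<Rightarrow> 'a \<Rightarrow> 'a" where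
  "T_on_prod3 A B D f =
     (inv_arr C (Tcomp C A B) \<otimes> Idt C (TO C D)) \<cdot> inv_arr C (Tcomp C (Prd C A B) D) \<cdot> TA C f"

definition mult3 :: "'o \<Rightarrow> 'a \<Rightarrow> 'a" where
  "mult3 G m = (m \<otimes> Idt C G) \<cdot> m"

text \<open>
  In the following, \<open>P\<close> is the pullback \<open>T(G)\<^sub>u\<close> of \<open>p\<^sub>G\<close> along \<open>u : 1 \<rightarrow> G\<close>, and
  \<open>i : P \<rightarrow> T(G)\<close> is its projection \<open>p\<^sub>u\<^sup>*\<close>.
\<close>

definition into_fibre :: "'o \<Rightarrow> 'a \<Rightarrow> 'a \<Rightarrow> 'a" where
  "into_fibre P i h = mediating C P (bang C P) i (bang C (Dom C h)) h"

definition Ad_left :: "'o \<Rightarrow> 'a \<Rightarrow> 'a \<Rightarrow> 'o \<Rightarrow> 'a \<Rightarrow> 'a" where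
  "Ad_left G m \<iota> P i =
     into_fibre P i
       (\<langle>\<langle>prj0 C G P \<cdot> tzero C G, prj1 C G P \<cdot> i\<rangle>, prj0 C G P \<cdot> \<iota> \<cdot> tzero C G\<rangle>
          \<cdot> T_on_prod3 G G G (mult3 G m))"

definition T_inv_fibre :: "'a \<Rightarrow> 'o \<Rightarrow> 'a \<Rightarrow> 'a" where
  "T_inv_fibre \<iota> P i = into_fibre P i (i \<cdot> TA C \<iota>)"

definition triv :: "'o \<Rightarrow> 'a \<Rightarrow> 'a \<Rightarrow> 'o \<Rightarrow> 'a \<Rightarrow> 'a" where
  "triv G m \<iota> P i =
     \<langle>tp C G,
      into_fibre P i (\<langle>tp C G \<cdot> \<iota> \<cdot> tzero C G, Idt C (TO C G)\<rangle> \<cdot> T_on_prod G G m)\<rangle>"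

definition triv_inv :: "'o \<Rightarrow> 'a \<Rightarrow> 'a \<Rightarrow> 'a" where
  "triv_inv G m i = (tzero C G \<otimes> i) \<cdot> T_on_prod G G m"

end

end

theory Submission
  imports Defs "HOL-Algebra.Group"
begin

text \<open>
  The proof is a computation with generalised elements.  For a group object \<open>G\<close> and any object
  \<open>X\<close>, the maps \<open>X \<rightarrow> G\<close> form an ordinary group under \<open>a * b = \<langle>a, b\<rangle> \<cdot> m\<close>, with inverses
  \<open>a \<cdot> \<iota>\<close> (\<open>elements_group\<close>).  Since \<open>T\<close> preserves finite products, the maps \<open>X \<rightarrow> T(G)\<close> form a
  group under \<open>a \<bullet> b = \<langle>a, b\<rangle> \<cdot> T(m)\<close>, with inverses \<open>a\<^sup>- = a \<cdot> T(\<iota>)\<close> (\<open>T_elements_group\<close>,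
  \<open>T_elements_inv\<close>).  By naturality of \<open>p\<close>, composition with \<open>p\<close> is a homomorphism from the second
  group to the first (\<open>Tm_tp\<close>), and by naturality of \<open>0\<close> the inverse of \<open>g0\<close> is \<open>g\<iota>0\<close>
  (\<open>T_elements_inv_zero\<close>).

  On elements \<open>x\<close> of \<open>T(G)\<close>, \<open>g\<close> of \<open>G\<close> and \<open>v\<close> of the fibre over the unit, the latter regarded as
  a subset of \<open>T(G)\<close>, the maps in question are
  \[ \phi(x) = (xp, (xp0)^- \bullet x), \quad \phi^{-1}(g, v) = g0 \bullet v, \quad
     \mathrm{Ad}(g, v) = g0 \bullet v \bullet (g0)^-. \]
  That \<open>\<phi>\<close> and \<open>\<phi>\<^sup>-\<^sup>1\<close> are mutually inverse is then cancellation in a group together with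
  \<open>(g0 \<bullet> v)p = g\<close>, which holds because \<open>v\<close> lies over the unit.  For the inversion, put
  \<open>y = g0 \<bullet> v\<close>.  Its inverse lies over \<open>g\<iota>\<close>, so the second component of \<open>\<phi>(y\<^sup>-)\<close> is
  \[ (g\iota 0)^- \bullet y^- = (y \bullet (g0)^-)^- = (\mathrm{Ad}(g, v))^- , \]
  where the first step is the rule for the inverse of a product.  This is the claim, since
  \<open>T(\<iota>)\<^sub>u\<close> is the restriction of the inversion to the fibre.

  Equations between maps into \<open>G \<times> T(G)\<^sub>u\<close> are tested after composing with the projection to \<open>G\<close>
  and with the map to \<open>T(G)\<close> (\<open>into_trivialisation_eqI\<close>), where
  maps defined by the universal property of the fibre become explicit products in the group.
\<close>

(* Frees \<otimes>, which is also the product of a monoid, for the product of two maps. *)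
no_notation monoid.mult (infixl "\<otimes>\<index>" 70)

section \<open>Arrows, products and pullbacks\<close>

text \<open>
  Typing is done by rewriting: membership in a hom-set is unfolded into equations for domain and
  codomain, so that the simplifier decides composability and the laws below become rewrite rules
  that right-associate composites and push composition into pairs.
\<close>

lemma Hom_iff: "f \<in> Hom\<^bsub>C\<^esub> A B \<longleftrightarrow> f \<in> Arr C \<and> Dom C f = A \<and> Cod C f = B"
  by (simp add: Hom_def)

context category
begin

lemma comp_simps [simp]:
  assumes "f \<in> Arr C" "g \<in> Arr C" "Cod C f = Dom C g"
  shows "f \<cdot> g \<in> Arr C" "Dom C (f \<cdot> g) = Dom C f" "Cod C (f \<cdot> g) = Cod C g"
  using Comp_Hom[of f "Dom C f" "Cod C f" g "Cod C g"] assms by (auto simp: Hom_iff)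

lemma Idt_simps [simp]:
  assumes "A \<in> Ob C"
  shows "Idt C A \<in> Arr C" "Dom C (Idt C A) = A" "Cod C (Idt C A) = A"
  using Idt_Hom[OF assms] by (auto simp: Hom_iff)

lemma Idt_comp [simp]: "\<lbrakk>f \<in> Arr C; Dom C f = A\<rbrakk> \<Longrightarrow> Idt C A \<cdot> f = f"
  using Idt_Comp[of f A "Cod C f"] by (simp add: Hom_iff)

lemma comp_Idt [simp]: "\<lbrakk>f \<in> Arr C; Cod C f = A\<rbrakk> \<Longrightarrow> f \<cdot> Idt C A = f"
  using Comp_Idt[of f "Dom C f" A] by (simp add: Hom_iff)

lemma comp_assoc [simp]:
  "\<lbrakk>f \<in> Arr C; g \<in> Arr C; h \<in> Arr C; Cod C f = Dom C g; Cod C g = Dom C h\<rbrakk>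
    \<Longrightarrow> (f \<cdot> g) \<cdot> h = f \<cdot> (g \<cdot> h)"
  using Comp_assoc[of f "Dom C f" "Cod C f" g "Cod C g" h "Cod C h"] by (simp add: Hom_iff)

lemma inverse_arrows_unique:
  assumes "inverse_arrows C f g" "inverse_arrows C f h"
  shows "g = h"
proof -
  have "g = g \<cdot> (f \<cdot> h)"
    using assms by (auto simp: inverse_arrows_def Hom_iff)
  also have "\<dots> = (g \<cdot> f) \<cdot> h"
    by (rule comp_assoc[symmetric]) (use assms in \<open>simp_all add: inverse_arrows_def Hom_iff\<close>)
  also have "\<dots> = h"
    using assms by (auto simp: inverse_arrows_def Hom_iff)
  finally show ?thesis .
qed

(* The name is_iso alone would denote isomorphism of groups. *)
lemma inverse_inv_arr: "Defs.is_iso C f \<Longrightarrow> inverse_arrows C f (inv_arr C f)"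
  unfolding Defs.is_iso_def inv_arr_def by (metis inverse_arrows_unique theI)

end

context cartesian_tangent_category
begin

lemma One_Ob [simp]: "One C \<in> Ob C"
  using One_terminal by (simp add: is_terminal_def)

lemma bang_simps [simp]:
  assumes "A \<in> Ob C"
  shows "bang C A \<in> Arr C" "Dom C (bang C A) = A" "Cod C (bang C A) = One C"
proof -
  have "bang C A \<in> Hom A (One C)"
    unfolding bang_def by (rule theI') (use One_terminal assms in \<open>simp add: is_terminal_def\<close>)
  then show "bang C A \<in> Arr C" "Dom C (bang C A) = A" "Cod C (bang C A) = One C"
    by (auto simp: Hom_iff)
qed

lemma into_One_unique:
  assumes "f \<in> Arr C" "g \<in> Arr C" "Dom C f = Dom C g" "Cod C f = One C" "Cod C g = One C"
  shows "f = g"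
proof -
  have "\<exists>!h. h \<in> Hom (Dom C f) (One C)"
    using One_terminal Dom_Ob[OF assms(1)] by (simp add: is_terminal_def)
  moreover have "f \<in> Hom (Dom C f) (One C)" "g \<in> Hom (Dom C f) (One C)"
    using assms by (auto simp: Hom_iff)
  ultimately show ?thesis
    by (elim ex1E) metis
qed

lemma comp_bang [simp]: "\<lbrakk>f \<in> Arr C; Cod C f = A; A \<in> Ob C\<rbrakk> \<Longrightarrow> f \<cdot> bang C A = bang C (Dom C f)"
  by (rule into_One_unique) (auto simp: Dom_Ob)

text \<open>
  Since composites are right-associated, each rule for a composite \<open>f \<cdot> g\<close> needs a companion for
  \<open>f \<cdot> (g \<cdot> h)\<close>.
\<close>

lemma comp_bang_comp [simp]:
  "\<lbrakk>f \<in> Arr C; Cod C f = A; A \<in> Ob C; h \<in> Arr C; Dom C h = One C\<rbrakk>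
    \<Longrightarrow> f \<cdot> (bang C A \<cdot> h) = bang C (Dom C f) \<cdot> h"
  using comp_assoc[of f "bang C A" h] by simp

lemma prj_simps [simp]:
  assumes "A \<in> Ob C" "B \<in> Ob C"
  shows "prj0 C A B \<in> Arr C" "Dom C (prj0 C A B) = Prd C A B" "Cod C (prj0 C A B) = A"
    and "prj1 C A B \<in> Arr C" "Dom C (prj1 C A B) = Prd C A B" "Cod C (prj1 C A B) = B"
    and "Prd C A B \<in> Ob C"
  using Prd_product[OF assms] Dom_Ob[of "prj0 C A B"] by (auto simp: is_product_def Hom_iff)

lemma pair_universal:
  assumes "f \<in> Arr C" "g \<in> Arr C" "Dom C f = Dom C g"
  shows "\<exists>!w. w \<in> Hom (Dom C f) (Prd C (Cod C f) (Cod C g)) \<and>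
      w \<cdot> prj0 C (Cod C f) (Cod C g) = f \<and> w \<cdot> prj1 C (Cod C f) (Cod C g) = g"
  using Prd_product[of "Cod C f" "Cod C g"] assms Cod_Ob
  by (simp add: is_product_def Hom_iff)

lemma pair_simps [simp]:
  assumes "f \<in> Arr C" "g \<in> Arr C" "Dom C f = Dom C g"
  shows "\<langle>f, g\<rangle> \<in> Arr C" "Dom C \<langle>f, g\<rangle> = Dom C f" "Cod C \<langle>f, g\<rangle> = Prd C (Cod C f) (Cod C g)"
    and "\<lbrakk>Cod C f = A; Cod C g = B\<rbrakk> \<Longrightarrow> \<langle>f, g\<rangle> \<cdot> prj0 C A B = f"
    and "\<lbrakk>Cod C f = A; Cod C g = B\<rbrakk> \<Longrightarrow> \<langle>f, g\<rangle> \<cdot> prj1 C A B = g"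
  using theI'[OF pair_universal[OF assms]]
  unfolding pair_def mediating_def by (auto simp: Hom_iff)

lemma pair_prj_comp [simp]:
  assumes "f \<in> Arr C" "g \<in> Arr C" "Dom C f = Dom C g" "Cod C f = A" "Cod C g = B" "h \<in> Arr C"
  shows "Dom C h = A \<Longrightarrow> \<langle>f, g\<rangle> \<cdot> (prj0 C A B \<cdot> h) = f \<cdot> h"
    and "Dom C h = B \<Longrightarrow> \<langle>f, g\<rangle> \<cdot> (prj1 C A B \<cdot> h) = g \<cdot> h"
proof -
  have "A \<in> Ob C" "B \<in> Ob C"
    using assms Cod_Ob by auto
  then show "Dom C h = A \<Longrightarrow> \<langle>f, g\<rangle> \<cdot> (prj0 C A B \<cdot> h) = f \<cdot> h"
    and "Dom C h = B \<Longrightarrow> \<langle>f, g\<rangle> \<cdot> (prj1 C A B \<cdot> h) = g \<cdot> h"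
    using comp_assoc[of "\<langle>f, g\<rangle>" "prj0 C A B" h] comp_assoc[of "\<langle>f, g\<rangle>" "prj1 C A B" h]
      assms by (simp_all del: comp_assoc)
qed

lemma pair_eqI:
  assumes "v \<in> Arr C" "w \<in> Arr C" "Dom C v = Dom C w"
    and "Cod C v = Prd C A B" "Cod C w = Prd C A B" "A \<in> Ob C" "B \<in> Ob C"
    and "v \<cdot> prj0 C A B = w \<cdot> prj0 C A B" "v \<cdot> prj1 C A B = w \<cdot> prj1 C A B"
  shows "v = w"
  using pair_universal[of "v \<cdot> prj0 C A B" "v \<cdot> prj1 C A B"] assms by (auto simp: Hom_iff)

lemma comp_pair [simp]:
  assumes "h \<in> Arr C" "f \<in> Arr C" "g \<in> Arr C" "Dom C f = Dom C g" "Cod C h = Dom C f"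
  shows "h \<cdot> \<langle>f, g\<rangle> = \<langle>h \<cdot> f, h \<cdot> g\<rangle>"
  by (rule pair_eqI[of _ _ "Cod C f" "Cod C g"]) (use assms Cod_Ob in auto)

lemma comp_pair_comp [simp]:
  assumes "h \<in> Arr C" "f \<in> Arr C" "g \<in> Arr C" "Dom C f = Dom C g" "Cod C h = Dom C f"
    and "k \<in> Arr C" "Dom C k = Prd C (Cod C f) (Cod C g)"
  shows "h \<cdot> (\<langle>f, g\<rangle> \<cdot> k) = \<langle>h \<cdot> f, h \<cdot> g\<rangle> \<cdot> k"
  using comp_assoc[of h "\<langle>f, g\<rangle>" k] assms by (simp del: comp_assoc)

lemma pair_prj:
  assumes "w \<in> Arr C" "Cod C w = Prd C A B" "A \<in> Ob C" "B \<in> Ob C"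
  shows "\<langle>w \<cdot> prj0 C A B, w \<cdot> prj1 C A B\<rangle> = w"
  by (rule pair_eqI[of _ _ A B]) (use assms in auto)

lemma prod_map_simps [simp]:
  assumes "f \<in> Arr C" "g \<in> Arr C"
  shows "f \<otimes> g \<in> Arr C" "Dom C (f \<otimes> g) = Prd C (Dom C f) (Dom C g)"
    "Cod C (f \<otimes> g) = Prd C (Cod C f) (Cod C g)"
  using assms Dom_Ob by (auto simp: prod_map_def)

lemma pair_prod_map [simp]:
  assumes "f \<in> Arr C" "g \<in> Arr C" "h \<in> Arr C" "k \<in> Arr C"
    "Dom C h = Dom C k" "Cod C h = Dom C f" "Cod C k = Dom C g"
  shows "\<langle>h, k\<rangle> \<cdot> (f \<otimes> g) = \<langle>h \<cdot> f, k \<cdot> g\<rangle>"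
  using assms Dom_Ob by (simp add: prod_map_def)

lemma pair_prod_map_comp [simp]:
  assumes "f \<in> Arr C" "g \<in> Arr C" "h \<in> Arr C" "k \<in> Arr C"
    "Dom C h = Dom C k" "Cod C h = Dom C f" "Cod C k = Dom C g"
    "l \<in> Arr C" "Dom C l = Prd C (Cod C f) (Cod C g)"
  shows "\<langle>h, k\<rangle> \<cdot> ((f \<otimes> g) \<cdot> l) = \<langle>h \<cdot> f, k \<cdot> g\<rangle> \<cdot> l"
  using comp_assoc[of "\<langle>h, k\<rangle>" "f \<otimes> g" l] assms by (simp del: comp_assoc)


section \<open>Tangent vectors of a product\<close>

lemma TO_Ob [simp]: "A \<in> Ob C \<Longrightarrow> TO C A \<in> Ob C"
  using T_functor by (simp add: is_endofunctor_def)

lemma TA_simps [simp]: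
  assumes "f \<in> Arr C"
  shows "TA C f \<in> Arr C" "Dom C (TA C f) = TO C (Dom C f)" "Cod C (TA C f) = TO C (Cod C f)"
  using T_functor assms by (auto simp: is_endofunctor_def Hom_iff)

lemma TA_Idt [simp]: "A \<in> Ob C \<Longrightarrow> TA C (Idt C A) = Idt C (TO C A)"
  using T_functor by (simp add: is_endofunctor_def)

lemma TA_comp:
  "\<lbrakk>f \<in> Arr C; g \<in> Arr C; Cod C f = Dom C g\<rbrakk> \<Longrightarrow> TA C (f \<cdot> g) = TA C f \<cdot> TA C g"
  using T_functor by (simp add: is_endofunctor_def Hom_iff)

lemma tp_simps [simp]:
  assumes "A \<in> Ob C"
  shows "tp C A \<in> Arr C" "Dom C (tp C A) = TO C A" "Cod C (tp C A) = A"
  using p_natural assms by (auto simp: is_natural_def Hom_iff)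

lemma tzero_simps [simp]:
  assumes "A \<in> Ob C"
  shows "tzero C A \<in> Arr C" "Dom C (tzero C A) = A" "Cod C (tzero C A) = TO C A"
  using zero_natural assms by (auto simp: is_natural_def Hom_iff)

lemma TA_tp: "f \<in> Arr C \<Longrightarrow> TA C f \<cdot> tp C (Cod C f) = tp C (Dom C f) \<cdot> f"
  using p_natural by (simp add: is_natural_def Hom_iff)

lemma tzero_TA: "f \<in> Arr C \<Longrightarrow> tzero C (Dom C f) \<cdot> TA C f = f \<cdot> tzero C (Cod C f)"
  using zero_natural by (simp add: is_natural_def Hom_iff)

lemma tzero_tp [simp]: "A \<in> Ob C \<Longrightarrow> tzero C A \<cdot> tp C A = Idt C A"
  using additive[of A] by (simp add: additive_bundle_def tangent_bundle_def)

lemma Tcomp_simps [simp]: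
  assumes "A \<in> Ob C" "B \<in> Ob C"
  shows "Tcomp C A B \<in> Arr C" "Dom C (Tcomp C A B) = TO C (Prd C A B)"
    "Cod C (Tcomp C A B) = Prd C (TO C A) (TO C B)"
  using assms by (auto simp: Tcomp_def)

lemma inv_Tcomp_simps [simp]:
  assumes "A \<in> Ob C" "B \<in> Ob C"
  shows "inv_arr C (Tcomp C A B) \<in> Arr C"
    "Dom C (inv_arr C (Tcomp C A B)) = Prd C (TO C A) (TO C B)"
    "Cod C (inv_arr C (Tcomp C A B)) = TO C (Prd C A B)"
    "Tcomp C A B \<cdot> inv_arr C (Tcomp C A B) = Idt C (TO C (Prd C A B))"
    "inv_arr C (Tcomp C A B) \<cdot> Tcomp C A B = Idt C (Prd C (TO C A) (TO C B))"
  using inverse_inv_arr[OF Tcomp_iso[OF assms]] assms by (auto simp: inverse_arrows_def Hom_iff)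

lemma T_on_prod_simps [simp]:
  assumes "A \<in> Ob C" "B \<in> Ob C" "f \<in> Arr C" "Dom C f = Prd C A B"
  shows "T_on_prod C A B f \<in> Arr C" "Dom C (T_on_prod C A B f) = Prd C (TO C A) (TO C B)"
    "Cod C (T_on_prod C A B f) = TO C (Cod C f)"
  using assms by (auto simp: T_on_prod_def)

lemma comp_Tcomp:
  assumes "w \<in> Hom X (TO C (Prd C A B))" "A \<in> Ob C" "B \<in> Ob C"
  shows "w \<cdot> Tcomp C A B = \<langle>w \<cdot> TA C (prj0 C A B), w \<cdot> TA C (prj1 C A B)\<rangle>"
  using assms by (simp add: Tcomp_def Hom_iff)

text \<open>
  \<open>T(A \<times> B)\<close> with the projections \<open>T(\<pi>\<^sub>0)\<close> and \<open>T(\<pi>\<^sub>1)\<close> is again a product, whose pairing is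
  \<open>\<langle>a, b\<rangle>\<close> followed by the inverse comparison.  Most later arguments use an element of
  \<open>T(A \<times> B)\<close> with prescribed projections and never look inside the comparison.
\<close>

lemma inv_Tcomp_TA_prj:
  assumes "a \<in> Hom X (TO C A)" "b \<in> Hom X (TO C B)" "A \<in> Ob C" "B \<in> Ob C"
  shows "\<langle>a, b\<rangle> \<cdot> inv_arr C (Tcomp C A B) \<cdot> TA C (prj0 C A B) = a"
    and "\<langle>a, b\<rangle> \<cdot> inv_arr C (Tcomp C A B) \<cdot> TA C (prj1 C A B) = b"
proof -
  let ?w = "\<langle>a, b\<rangle> \<cdot> inv_arr C (Tcomp C A B)"
  have w: "?w \<in> Hom X (TO C (Prd C A B))"
    using assms by (auto simp: Hom_iff)
  have "?w \<cdot> Tcomp C A B = \<langle>a, b\<rangle>"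
    using assms by (simp add: Hom_iff)
  then have *: "\<langle>?w \<cdot> TA C (prj0 C A B), ?w \<cdot> TA C (prj1 C A B)\<rangle> = \<langle>a, b\<rangle>"
    unfolding comp_Tcomp[OF w assms(3,4)] .
  show "?w \<cdot> TA C (prj0 C A B) = a"
    using arg_cong[OF *, of "\<lambda>x. x \<cdot> prj0 C (TO C A) (TO C B)"] w assms
    by (simp add: Hom_iff del: comp_assoc)
  show "?w \<cdot> TA C (prj1 C A B) = b"
    using arg_cong[OF *, of "\<lambda>x. x \<cdot> prj1 C (TO C A) (TO C B)"] w assms
    by (simp add: Hom_iff del: comp_assoc)
qed

lemma T_prod_liftE:
  assumes "a \<in> Hom X (TO C A)" "b \<in> Hom X (TO C B)" "A \<in> Ob C" "B \<in> Ob C"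
  obtains w where "w \<in> Hom X (TO C (Prd C A B))"
    "w \<cdot> TA C (prj0 C A B) = a" "w \<cdot> TA C (prj1 C A B) = b"
  using inv_Tcomp_TA_prj[OF assms] assms
  by (intro that[of "\<langle>a, b\<rangle> \<cdot> inv_arr C (Tcomp C A B)"]) (auto simp: Hom_iff)

lemma pair_T_on_prod:
  assumes "w \<in> Hom X (TO C (Prd C A B))" "A \<in> Ob C" "B \<in> Ob C"
    and "f \<in> Arr C" "Dom C f = Prd C A B"
  shows "\<langle>w \<cdot> TA C (prj0 C A B), w \<cdot> TA C (prj1 C A B)\<rangle> \<cdot> T_on_prod C A B f = w \<cdot> TA C f"
proof -
  have "\<langle>w \<cdot> TA C (prj0 C A B), w \<cdot> TA C (prj1 C A B)\<rangle> = w \<cdot> Tcomp C A B"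
    using assms by (simp add: Tcomp_def Hom_iff)
  moreover have "Tcomp C A B \<cdot> (inv_arr C (Tcomp C A B) \<cdot> TA C f) = TA C f"
    using comp_assoc[of "Tcomp C A B" "inv_arr C (Tcomp C A B)" "TA C f"] assms
    by (simp del: comp_assoc)
  ultimately show ?thesis
    using assms by (simp add: T_on_prod_def Hom_iff)
qed

text \<open>
  An element \<open>w\<close> of \<open>T(Y)\<close> carries operations on maps out of \<open>Y\<close> to operations on elements of
  tangent bundles.  Taking for \<open>Y\<close> a power of \<open>G\<close> transports algebraic laws from \<open>G\<close> to
  \<open>T(G)\<close>.
\<close>

lemma pair_TA_T_on_prod:
  assumes "w \<in> Hom X (TO C Y)" "f \<in> Hom Y A" "g \<in> Hom Y B" "k \<in> Arr C" "Dom C k = Prd C A B"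
  shows "\<langle>w \<cdot> TA C f, w \<cdot> TA C g\<rangle> \<cdot> T_on_prod C A B k = w \<cdot> TA C (\<langle>f, g\<rangle> \<cdot> k)"
proof -
  have Ob: "A \<in> Ob C" "B \<in> Ob C" "Y \<in> Ob C"
    using assms Cod_Ob Dom_Ob by (auto simp: Hom_iff)
  have "TA C \<langle>f, g\<rangle> \<cdot> TA C (prj0 C A B) = TA C f" "TA C \<langle>f, g\<rangle> \<cdot> TA C (prj1 C A B) = TA C g"
    using assms Ob by (auto simp: Hom_iff TA_comp[symmetric])
  then show ?thesis
    using pair_T_on_prod[of "w \<cdot> TA C \<langle>f, g\<rangle>" X A B k] assms Ob by (simp add: Hom_iff TA_comp)
qed

lemma into_T_One_unique:
  assumes "f \<in> Arr C" "g \<in> Arr C" "Dom C f = Dom C g"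
    "Cod C f = TO C (One C)" "Cod C g = TO C (One C)"
  shows "f = g"
proof -
  let ?b = "bang C (TO C (One C))"
  obtain k where k: "k \<in> Arr C" "Dom C k = One C" "?b \<cdot> k = Idt C (TO C (One C))"
    using T_One_iso by (auto simp: Defs.is_iso_def inverse_arrows_def Hom_iff)
  have "f = f \<cdot> (?b \<cdot> k)" "g = g \<cdot> (?b \<cdot> k)"
    using assms k(3) by simp_all
  then show ?thesis
    using assms k(1,2) by simp
qed

end


section \<open>Groups of generalised elements\<close>

text \<open>
  The group structure that a group object induces on the maps into it, by the Yoneda lemma.
\<close>

definition elements ::
  "('o, 'a, 'z) cartesian_tangent_category_scheme \<Rightarrow> 'o \<Rightarrow> 'o \<Rightarrow> 'a \<Rightarrow> 'a \<Rightarrow> 'a monoid" where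
  "elements C X G m u =
     \<lparr>carrier = Hom\<^bsub>C\<^esub> X G, monoid.mult = (\<lambda>a b. \<langle>a, b\<rangle>\<^bsub>C\<^esub> \<cdot>\<^bsub>C\<^esub> m), one = bang C X \<cdot>\<^bsub>C\<^esub> u\<rparr>"

locale tangent_group = cartesian_tangent_category C
  for C :: "('o, 'a, 'z) cartesian_tangent_category_scheme" (structure) +
  fixes G :: 'o and m u \<iota> :: 'a
  assumes grp: "group_object C G m u \<iota>"
begin

lemma G_Ob [simp]: "G \<in> Ob C"
  using grp by (simp add: group_object_def)

lemma group_arrows [simp]:
  "m \<in> Arr C" "Dom C m = Prd C G G" "Cod C m = G"
  "u \<in> Arr C" "Dom C u = One C" "Cod C u = G"
  "\<iota> \<in> Arr C" "Dom C \<iota> = G" "Cod C \<iota> = G"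
  using grp by (auto simp: group_object_def Hom_iff)

definition Tm :: 'a where "Tm = T_on_prod C G G m"

lemma Tm_simps [simp]: "Tm \<in> Arr C" "Dom C Tm = Prd C (TO C G) (TO C G)" "Cod C Tm = TO C G"
  by (auto simp: Tm_def)

abbreviation "G_elements X \<equiv> elements C X G m u"

abbreviation "TG_elements X \<equiv> elements C X (TO C G) Tm (u \<cdot> tzero C G)"

lemma elements_inverse:
  assumes "a \<in> Hom X G"
  shows "\<langle>a \<cdot> \<iota>, a\<rangle> \<cdot> m = bang C X \<cdot> u"
proof -
  have "a \<cdot> (\<langle>\<iota>, Idt C G\<rangle> \<cdot> m) = a \<cdot> (bang C G \<cdot> u)"
    using grp by (simp add: group_object_def)
  then show "\<langle>a \<cdot> \<iota>, a\<rangle> \<cdot> m = bang C X \<cdot> u"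
    using assms by (auto simp: Hom_iff)
qed

lemma elements_group:
  assumes X [simp]: "X \<in> Ob C"
  shows "group (G_elements X)"
proof (rule groupI, goal_cases)
  case (1 a b)
  then show ?case by (simp add: elements_def Hom_iff)
next
  case 2
  show ?case by (simp add: elements_def Hom_iff)
next
  case (3 a b c)
  then have t: "a \<in> Hom X G" "b \<in> Hom X G" "c \<in> Hom X G"
    by (auto simp: elements_def)
  have "\<langle>\<langle>a, b\<rangle>, c\<rangle> \<cdot> ((m \<otimes> Idt C G) \<cdot> m)
      = \<langle>\<langle>a, b\<rangle>, c\<rangle> \<cdot> (assoc_map C G G G \<cdot> (Idt C G \<otimes> m) \<cdot> m)"
    using grp by (simp add: group_object_def)
  then show ?case using t by (simp add: elements_def Hom_iff assoc_map_def)
next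
  case (4 a)
  have "a \<cdot> (\<langle>bang C G \<cdot> u, Idt C G\<rangle> \<cdot> m) = a \<cdot> Idt C G"
    using grp by (simp add: group_object_def)
  with 4 show ?case by (simp add: elements_def Hom_iff)
next
  case (5 a)
  then show ?case using elements_inverse[of a X]
    by (intro bexI[of _ "a \<cdot> \<iota>"]) (auto simp: elements_def Hom_iff)
qed

lemma Tm_TA:
  assumes "w \<in> Hom X (TO C Y)" "f \<in> Hom Y G" "g \<in> Hom Y G"
  shows "\<langle>w \<cdot> TA C f, w \<cdot> TA C g\<rangle> \<cdot> Tm = w \<cdot> TA C (\<langle>f, g\<rangle> \<cdot> m)"
  unfolding Tm_def by (rule pair_TA_T_on_prod) (use assms in auto)

text \<open>
  The constant map at the unit becomes the constant map at the zero vector over the unit, because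
  \<open>T(1)\<close> is terminal and \<open>0\<close> is natural.  Hence \<open>u \<cdot> 0\<close> is the unit of \<open>T(G)\<close>.
\<close>

lemma T_unit:
  assumes "w \<in> Hom X (TO C Y)" "Y \<in> Ob C"
  shows "w \<cdot> TA C (bang C Y \<cdot> u) = bang C X \<cdot> (u \<cdot> tzero C G)"
proof -
  have [simp]: "X \<in> Ob C" using assms Dom_Ob by (auto simp: Hom_iff)
  have "w \<cdot> TA C (bang C Y) = bang C X \<cdot> tzero C (One C)"
    by (rule into_T_One_unique) (use assms in \<open>auto simp: Hom_iff\<close>)
  then have "(w \<cdot> TA C (bang C Y)) \<cdot> TA C u = (bang C X \<cdot> tzero C (One C)) \<cdot> TA C u"
    by simp
  then show ?thesis
    using assms tzero_TA[of u] by (simp add: Hom_iff TA_comp)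
qed

lemma T_elements_inverse:
  assumes "a \<in> Hom X (TO C G)"
  shows "\<langle>a \<cdot> TA C \<iota>, a\<rangle> \<cdot> Tm = bang C X \<cdot> (u \<cdot> tzero C G)"
proof -
  have "\<langle>a \<cdot> TA C \<iota>, a \<cdot> TA C (Idt C G)\<rangle> \<cdot> Tm = a \<cdot> TA C (\<langle>\<iota>, Idt C G\<rangle> \<cdot> m)"
    by (rule Tm_TA) (use assms in \<open>auto simp: Hom_iff\<close>)
  also have "\<dots> = a \<cdot> TA C (bang C G \<cdot> u)"
    using grp by (simp add: group_object_def)
  finally show ?thesis
    using assms T_unit[OF assms] by (simp add: Hom_iff)
qed

text \<open>
  The group laws are transported along \<open>Tm_TA\<close>.  For associativity, three elements of \<open>T(G)\<close>
  combine into a single element \<open>w\<close> of \<open>T((G \<times> G) \<times> G)\<close>, and the law holds for the three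
  projections \<open>(G \<times> G) \<times> G \<rightarrow> G\<close> in the group of generalised elements of \<open>G\<close>.
\<close>

lemma T_elements_group:
  assumes X [simp]: "X \<in> Ob C"
  shows "group (TG_elements X)"
proof (rule groupI, goal_cases)
  case (1 a b)
  then show ?case by (simp add: elements_def Hom_iff)
next
  case 2
  show ?case by (simp add: elements_def Hom_iff)
next
  case (3 a b c)
  then have t: "a \<in> Hom X (TO C G)" "b \<in> Hom X (TO C G)" "c \<in> Hom X (TO C G)"
    by (auto simp: elements_def)
  let ?Y = "Prd C (Prd C G G) G"
  obtain v where v: "v \<in> Hom X (TO C (Prd C G G))"
      "v \<cdot> TA C (prj0 C G G) = a" "v \<cdot> TA C (prj1 C G G) = b"
    using T_prod_liftE[OF t(1,2)] by auto
  obtain w where w: "w \<in> Hom X (TO C ?Y)"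
      "w \<cdot> TA C (prj0 C (Prd C G G) G) = v" "w \<cdot> TA C (prj1 C (Prd C G G) G) = c"
    using T_prod_liftE[OF v(1) t(3)] by auto
  define f g h where "f = prj0 C (Prd C G G) G \<cdot> prj0 C G G"
    and "g = prj0 C (Prd C G G) G \<cdot> prj1 C G G" and "h = prj1 C (Prd C G G) G"
  have fgh: "f \<in> Hom ?Y G" "g \<in> Hom ?Y G" "h \<in> Hom ?Y G"
    by (auto simp: f_def g_def h_def Hom_iff)
  have "w \<cdot> TA C f = (w \<cdot> TA C (prj0 C (Prd C G G) G)) \<cdot> TA C (prj0 C G G)"
       "w \<cdot> TA C g = (w \<cdot> TA C (prj0 C (Prd C G G) G)) \<cdot> TA C (prj1 C G G)"
    using w(1) by (auto simp: f_def g_def TA_comp Hom_iff)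
  then have abc: "w \<cdot> TA C f = a" "w \<cdot> TA C g = b" "w \<cdot> TA C h = c"
    using v w by (auto simp: h_def)
  interpret E: group "G_elements ?Y"
    by (rule elements_group) simp
  have fg: "\<langle>f, g\<rangle> \<cdot> m \<in> Hom ?Y G" "\<langle>g, h\<rangle> \<cdot> m \<in> Hom ?Y G"
    using fgh by (auto simp: Hom_iff)
  have "\<langle>\<langle>a, b\<rangle> \<cdot> Tm, c\<rangle> \<cdot> Tm = w \<cdot> TA C (\<langle>\<langle>f, g\<rangle> \<cdot> m, h\<rangle> \<cdot> m)"
    using Tm_TA[OF w(1) fgh(1,2)] Tm_TA[OF w(1) fg(1) fgh(3)] abc by simp
  also have "\<langle>\<langle>f, g\<rangle> \<cdot> m, h\<rangle> \<cdot> m = \<langle>f, \<langle>g, h\<rangle> \<cdot> m\<rangle> \<cdot> m"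
    using E.m_assoc[of f g h] fgh by (simp add: elements_def)
  also have "w \<cdot> TA C (\<langle>f, \<langle>g, h\<rangle> \<cdot> m\<rangle> \<cdot> m) = \<langle>a, \<langle>b, c\<rangle> \<cdot> Tm\<rangle> \<cdot> Tm"
    using Tm_TA[OF w(1) fgh(2,3)] Tm_TA[OF w(1) fgh(1) fg(2)] abc by simp
  finally show ?case by (simp add: elements_def)
next
  case (4 a)
  then have a: "a \<in> Hom X (TO C G)" by (simp add: elements_def)
  have "\<langle>a \<cdot> TA C (bang C G \<cdot> u), a \<cdot> TA C (Idt C G)\<rangle> \<cdot> Tm = a \<cdot> TA C (\<langle>bang C G \<cdot> u, Idt C G\<rangle> \<cdot> m)"
    by (rule Tm_TA) (use a in \<open>auto simp: Hom_iff\<close>)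
  also have "\<dots> = a \<cdot> TA C (Idt C G)"
    using grp by (simp add: group_object_def)
  finally show ?case
    using a T_unit[OF a] by (simp add: elements_def Hom_iff)
next
  case (5 a)
  then show ?case using T_elements_inverse[of a X]
    by (intro bexI[of _ "a \<cdot> TA C \<iota>"]) (auto simp: elements_def Hom_iff)
qed

text \<open>
  This is naturality of \<open>p\<close> at \<open>m\<close>, once \<open>a\<close> and \<open>b\<close> are combined into an element \<open>w\<close> of
  \<open>T(G \<times> G)\<close>: naturality at the two projections of \<open>G \<times> G\<close> identifies the base point of \<open>w\<close>.
\<close>

lemma Tm_tp:
  assumes "a \<in> Hom X (TO C G)" "b \<in> Hom X (TO C G)"
  shows "\<langle>a, b\<rangle> \<cdot> (Tm \<cdot> tp C G) = \<langle>a \<cdot> tp C G, b \<cdot> tp C G\<rangle> \<cdot> m"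
proof -
  obtain w where w: "w \<in> Hom X (TO C (Prd C G G))"
      "w \<cdot> TA C (prj0 C G G) = a" "w \<cdot> TA C (prj1 C G G) = b"
    using T_prod_liftE[OF assms] by auto
  have "\<langle>a, b\<rangle> \<cdot> Tm = w \<cdot> TA C m"
    using pair_T_on_prod[OF w(1), of m] w by (simp add: Tm_def)
  then have "\<langle>a, b\<rangle> \<cdot> (Tm \<cdot> tp C G) = w \<cdot> (TA C m \<cdot> tp C G)"
    using assms w(1) comp_assoc[of "\<langle>a, b\<rangle>" Tm "tp C G"] by (simp add: Hom_iff)
  also have "\<dots> = w \<cdot> tp C (Prd C G G) \<cdot> m"
    using TA_tp[of m] w(1) by (simp add: Hom_iff)
  also have "w \<cdot> tp C (Prd C G G) = \<langle>a \<cdot> tp C G, b \<cdot> tp C G\<rangle>"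
  proof (rule pair_eqI[of _ _ G G])
    show "w \<cdot> tp C (Prd C G G) \<cdot> prj0 C G G = \<langle>a \<cdot> tp C G, b \<cdot> tp C G\<rangle> \<cdot> prj0 C G G"
      using assms w(1) TA_tp[of "prj0 C G G"] unfolding w(2)[symmetric]
      by (simp add: Hom_iff)
    show "w \<cdot> tp C (Prd C G G) \<cdot> prj1 C G G = \<langle>a \<cdot> tp C G, b \<cdot> tp C G\<rangle> \<cdot> prj1 C G G"
      using assms w(1) TA_tp[of "prj1 C G G"] unfolding w(3)[symmetric]
      by (simp add: Hom_iff)
  qed (use assms w(1) in \<open>auto simp: Hom_iff\<close>)
  finally show ?thesis .
qed

text \<open>
  Both sides are the triple product: functoriality of \<open>T\<close> splits \<open>T(m\<^sub>3)\<close> into two applications of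
  \<open>T(m)\<close>.
\<close>

lemma pair_mult3:
  assumes "a \<in> Hom X (TO C G)" "b \<in> Hom X (TO C G)" "c \<in> Hom X (TO C G)"
  shows "\<langle>\<langle>a, b\<rangle>, c\<rangle> \<cdot> T_on_prod3 C G G G (mult3 C G m) = \<langle>\<langle>a, b\<rangle> \<cdot> Tm, c\<rangle> \<cdot> Tm"
proof -
  define v where "v = \<langle>a, b\<rangle> \<cdot> inv_arr C (Tcomp C G G)"
  define w where "w = \<langle>v, c\<rangle> \<cdot> inv_arr C (Tcomp C (Prd C G G) G)"
  have v: "v \<in> Hom X (TO C (Prd C G G))"
    using assms by (auto simp: v_def Hom_iff)
  have w: "w \<in> Hom X (TO C (Prd C (Prd C G G) G))"
    using assms v by (auto simp: w_def Hom_iff)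
  have w0: "w \<cdot> TA C (prj0 C (Prd C G G) G) = v" and w1: "w \<cdot> TA C (prj1 C (Prd C G G) G) = c"
    unfolding w_def using inv_Tcomp_TA_prj[OF v assms(3)] by auto
  have "\<langle>\<langle>a, b\<rangle>, c\<rangle> \<cdot> T_on_prod3 C G G G (mult3 C G m) = w \<cdot> TA C (mult3 C G m)"
    using assms by (simp add: T_on_prod3_def mult3_def v_def w_def Hom_iff)
  also have "\<dots> = w \<cdot> TA C (\<langle>prj0 C (Prd C G G) G \<cdot> m, prj1 C (Prd C G G) G\<rangle> \<cdot> m)"
    by (simp add: mult3_def prod_map_def)
  also have "\<dots> = \<langle>w \<cdot> TA C (prj0 C (Prd C G G) G \<cdot> m), w \<cdot> TA C (prj1 C (Prd C G G) G)\<rangle> \<cdot> Tm"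
    by (rule Tm_TA[symmetric]) (use w in \<open>auto simp: Hom_iff\<close>)
  also have "w \<cdot> TA C (prj0 C (Prd C G G) G \<cdot> m) = (w \<cdot> TA C (prj0 C (Prd C G G) G)) \<cdot> TA C m"
    using w by (simp add: TA_comp Hom_iff)
  also have "\<dots> = \<langle>a, b\<rangle> \<cdot> Tm"
    unfolding w0 using assms by (simp add: v_def Tm_def T_on_prod_def Hom_iff)
  finally show ?thesis
    unfolding w1 .
qed

lemma T_elements_inv:
  assumes "a \<in> Hom X (TO C G)" "X \<in> Ob C"
  shows "inv\<^bsub>TG_elements X\<^esub> a = a \<cdot> TA C \<iota>"
  using T_elements_inverse[OF assms(1)] assms
  by (intro group.inv_equality[OF T_elements_group]) (auto simp: elements_def Hom_iff)

lemma T_elements_inv_zero: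
  assumes "g \<in> Hom X G" "X \<in> Ob C"
  shows "inv\<^bsub>TG_elements X\<^esub> (g \<cdot> tzero C G) = g \<cdot> (\<iota> \<cdot> tzero C G)"
  using T_elements_inv[of "g \<cdot> tzero C G" X] tzero_TA[of \<iota>] assms by (simp add: Hom_iff)

end


section \<open>The fibre of the tangent bundle over the unit\<close>

locale tangent_group_fibre = tangent_group C G m u \<iota>
  for C :: "('o, 'a, 'z) cartesian_tangent_category_scheme" (structure) and G m u \<iota> +
  fixes P :: 'o and i :: 'a
  assumes pb: "is_pullback C P (bang C P) i u (tp C G)"
begin

lemma fibre_simps [simp]:
  "P \<in> Ob C" "i \<in> Arr C" "Dom C i = P" "Cod C i = TO C G" "i \<cdot> tp C G = bang C P \<cdot> u"
proof -
  have "bang C P \<in> Hom P (One C)" and i: "i \<in> Hom P (TO C G)" "bang C P \<cdot> u = i \<cdot> tp C G"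
    using pb by (auto simp: is_pullback_def)
  then show "P \<in> Ob C" "i \<in> Arr C" "Dom C i = P" "Cod C i = TO C G" "i \<cdot> tp C G = bang C P \<cdot> u"
    using Dom_Ob[of i] by (auto simp: Hom_iff)
qed

text \<open>
  As \<open>1\<close> is terminal, the fibre is the subobject of \<open>T(G)\<close> of all vectors over the unit.
\<close>

lemma fibre_lift_ex1:
  assumes "h \<in> Hom X (TO C G)" "h \<cdot> tp C G = bang C X \<cdot> u"
  shows "\<exists>!w. w \<in> Hom X P \<and> w \<cdot> bang C P = bang C X \<and> w \<cdot> i = h"
proof -
  have "X \<in> Ob C"
    using assms Dom_Ob by (auto simp: Hom_iff)
  then show ?thesis
    using pb assms by (simp add: is_pullback_def Hom_iff)
qed

lemma into_fibre_simps:
  assumes "h \<in> Hom X (TO C G)" "h \<cdot> tp C G = bang C X \<cdot> u"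
  shows "into_fibre C P i h \<in> Hom X P" "into_fibre C P i h \<cdot> i = h"
  using theI'[OF fibre_lift_ex1[OF assms]] assms(1)
  unfolding into_fibre_def mediating_def by (auto simp: Hom_iff Dom_Ob)

lemma fibre_mono:
  assumes "v \<in> Hom X P" "w \<in> Hom X P" "v \<cdot> i = w \<cdot> i"
  shows "v = w"
proof -
  have X: "X \<in> Ob C"
    using assms Dom_Ob by (auto simp: Hom_iff)
  have "\<exists>!z. z \<in> Hom X P \<and> z \<cdot> bang C P = bang C X \<and> z \<cdot> i = w \<cdot> i"
    by (rule fibre_lift_ex1) (use assms X in \<open>auto simp: Hom_iff\<close>)
  moreover have "v \<cdot> bang C P = bang C X" "w \<cdot> bang C P = bang C X"
    using assms by (auto simp: Hom_iff)
  ultimately show ?thesis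
    using assms by (elim ex1E) metis
qed

lemma into_trivialisation_eqI:
  assumes "v \<in> Hom X (Prd C G P)" "w \<in> Hom X (Prd C G P)"
    and "v \<cdot> prj0 C G P = w \<cdot> prj0 C G P" "v \<cdot> (prj1 C G P \<cdot> i) = w \<cdot> (prj1 C G P \<cdot> i)"
  shows "v = w"
proof (rule pair_eqI[of _ _ G P])
  show "v \<cdot> prj1 C G P = w \<cdot> prj1 C G P"
    by (rule fibre_mono[of _ X]) (use assms in \<open>auto simp: Hom_iff\<close>)
qed (use assms in \<open>auto simp: Hom_iff\<close>)


section \<open>The left trivialisation and the inversion\<close>

text \<open>
  For each map into the fibre that occurs in the theorem, its underlying vector has to be shown to
  lie over the unit, since only then is \<open>into_fibre\<close> meaningful.  Here
  \<open>(xp0)\<^sup>- \<bullet> x\<close> lies over \<open>(xp)\<^sup>-\<^sup>1 * xp\<close>.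
\<close>

lemma triv_simps [simp]:
  "triv C G m \<iota> P i \<in> Arr C" "Dom C (triv C G m \<iota> P i) = TO C G"
  "Cod C (triv C G m \<iota> P i) = Prd C G P"
  "triv C G m \<iota> P i \<cdot> prj0 C G P = tp C G"
  "triv C G m \<iota> P i \<cdot> (prj1 C G P \<cdot> i) = \<langle>tp C G \<cdot> \<iota> \<cdot> tzero C G, Idt C (TO C G)\<rangle> \<cdot> Tm"
proof -
  let ?h = "\<langle>tp C G \<cdot> \<iota> \<cdot> tzero C G, Idt C (TO C G)\<rangle> \<cdot> Tm"
  have h: "?h \<in> Hom (TO C G) (TO C G)"
    by (simp add: Hom_iff)
  have "?h \<cdot> tp C G = \<langle>tp C G \<cdot> \<iota>, tp C G\<rangle> \<cdot> m"
    using Tm_tp[of "tp C G \<cdot> \<iota> \<cdot> tzero C G" "TO C G" "Idt C (TO C G)"] by (simp add: Hom_iff)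
  also have "\<dots> = bang C (TO C G) \<cdot> u"
    by (rule elements_inverse) (simp add: Hom_iff)
  finally have "into_fibre C P i ?h \<in> Hom (TO C G) P" "into_fibre C P i ?h \<cdot> i = ?h"
    using into_fibre_simps[OF h] by auto
  then show "triv C G m \<iota> P i \<in> Arr C" "Dom C (triv C G m \<iota> P i) = TO C G"
    "Cod C (triv C G m \<iota> P i) = Prd C G P" "triv C G m \<iota> P i \<cdot> prj0 C G P = tp C G"
    "triv C G m \<iota> P i \<cdot> (prj1 C G P \<cdot> i) = ?h"
    unfolding triv_def Tm_def[symmetric] by (auto simp: Hom_iff)
qed

lemma triv_inv_simps [simp]:
  "triv_inv C G m i \<in> Arr C" "Dom C (triv_inv C G m i) = Prd C G P"
  "Cod C (triv_inv C G m i) = TO C G"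
  unfolding triv_inv_def Tm_def[symmetric] by auto

lemma triv_inv_eq: "triv_inv C G m i = \<langle>prj0 C G P \<cdot> tzero C G, prj1 C G P \<cdot> i\<rangle> \<cdot> Tm"
  by (simp add: triv_inv_def Tm_def prod_map_def)

lemma triv_inv_tp: "triv_inv C G m i \<cdot> tp C G = prj0 C G P"
proof -
  let ?X = "Prd C G P"
  interpret E: group "G_elements ?X"
    by (rule elements_group) simp
  have "triv_inv C G m i \<cdot> tp C G = \<langle>prj0 C G P, bang C ?X \<cdot> u\<rangle> \<cdot> m"
    using Tm_tp[of "prj0 C G P \<cdot> tzero C G" ?X "prj1 C G P \<cdot> i"]
    by (simp add: triv_inv_eq Hom_iff)
  also have "\<dots> = prj0 C G P"
    using E.r_one[of "prj0 C G P"] by (simp add: elements_def Hom_iff)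
  finally show ?thesis .
qed

text \<open>The conjugate \<open>g0 \<bullet> v \<bullet> (g0)\<^sup>-\<close> lies over \<open>g * g\<^sup>-\<^sup>1\<close>.\<close>

lemma Ad_left_simps [simp]:
  "Ad_left C G m \<iota> P i \<in> Arr C" "Dom C (Ad_left C G m \<iota> P i) = Prd C G P"
  "Cod C (Ad_left C G m \<iota> P i) = P"
  "Ad_left C G m \<iota> P i \<cdot> i
     = \<langle>triv_inv C G m i, prj0 C G P \<cdot> (\<iota> \<cdot> tzero C G)\<rangle> \<cdot> Tm"
proof -
  let ?X = "Prd C G P"
  let ?g = "prj0 C G P"
  let ?h = "\<langle>triv_inv C G m i, ?g \<cdot> (\<iota> \<cdot> tzero C G)\<rangle> \<cdot> Tm"
  have h: "?h \<in> Hom ?X (TO C G)"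
    by (simp add: Hom_iff)
  have "?h \<cdot> tp C G = \<langle>?g, ?g \<cdot> \<iota>\<rangle> \<cdot> m"
    using Tm_tp[of "triv_inv C G m i" ?X "?g \<cdot> (\<iota> \<cdot> tzero C G)"]
    by (simp add: triv_inv_tp Hom_iff)
  also have "\<dots> = ?g \<cdot> (\<langle>Idt C G, \<iota>\<rangle> \<cdot> m)"
    by simp
  also have "\<dots> = bang C ?X \<cdot> u"
    using grp by (simp add: group_object_def)
  finally have "into_fibre C P i ?h \<in> Hom ?X P" "into_fibre C P i ?h \<cdot> i = ?h"
    using into_fibre_simps[OF h] by auto
  moreover have "Ad_left C G m \<iota> P i = into_fibre C P i ?h"
    using pair_mult3[of "?g \<cdot> tzero C G" ?X "prj1 C G P \<cdot> i" "?g \<cdot> (\<iota> \<cdot> tzero C G)"]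
    by (simp add: Ad_left_def triv_inv_eq Hom_iff)
  ultimately show "Ad_left C G m \<iota> P i \<in> Arr C" "Dom C (Ad_left C G m \<iota> P i) = ?X"
    "Cod C (Ad_left C G m \<iota> P i) = P" "Ad_left C G m \<iota> P i \<cdot> i = ?h"
    by (auto simp: Hom_iff)
qed

text \<open>The inverse of a vector over the unit lies over \<open>u \<cdot> \<iota>\<close>, which is \<open>u\<close> again.\<close>

lemma T_inv_fibre_simps [simp]:
  "T_inv_fibre C \<iota> P i \<in> Arr C" "Dom C (T_inv_fibre C \<iota> P i) = P"
  "Cod C (T_inv_fibre C \<iota> P i) = P" "T_inv_fibre C \<iota> P i \<cdot> i = i \<cdot> TA C \<iota>"
proof -
  have h: "i \<cdot> TA C \<iota> \<in> Hom P (TO C G)"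
    by (simp add: Hom_iff)
  have "(i \<cdot> TA C \<iota>) \<cdot> tp C G = (i \<cdot> tp C G) \<cdot> \<iota>"
    using TA_tp[of \<iota>] by (simp del: fibre_simps(5))
  also have "\<dots> = bang C P \<cdot> (u \<cdot> \<iota>)"
    by simp
  also have "u \<cdot> \<iota> = u"
  proof -
    interpret E: group "G_elements (One C)"
      by (rule elements_group) simp
    have "bang C (One C) = Idt C (One C)"
      by (rule into_One_unique) auto
    then have one: "one (G_elements (One C)) = u"
      by (simp add: elements_def)
    have "u \<in> Hom (One C) G"
      by (simp add: Hom_iff)
    then have "inv\<^bsub>G_elements (One C)\<^esub> u = u \<cdot> \<iota>"
      using elements_inverse[of u "One C"]
      by (intro E.inv_equality) (auto simp: elements_def Hom_iff)
    then show ?thesis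
      using E.inv_one one by simp
  qed
  finally show "T_inv_fibre C \<iota> P i \<in> Arr C" "Dom C (T_inv_fibre C \<iota> P i) = P"
    "Cod C (T_inv_fibre C \<iota> P i) = P" "T_inv_fibre C \<iota> P i \<cdot> i = i \<cdot> TA C \<iota>"
    using into_fibre_simps[OF h] by (auto simp: T_inv_fibre_def Hom_iff)
qed

text \<open>
  For the identity \<open>x\<close> of \<open>T(G)\<close> and \<open>z = xp0\<close>, this is the cancellation \<open>z \<bullet> (z\<^sup>- \<bullet> x) = x\<close>.
\<close>

lemma triv_triv_inv: "triv C G m \<iota> P i \<cdot> triv_inv C G m i = Idt C (TO C G)"
proof -
  let ?X = "TO C G" and ?t = "triv C G m \<iota> P i"
  interpret E: group "TG_elements ?X"
    by (rule T_elements_group) simp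
  define z where "z = tp C G \<cdot> tzero C G"
  have z: "z \<in> Hom ?X (TO C G)"
    by (auto simp: z_def Hom_iff)
  have iz: "inv\<^bsub>TG_elements ?X\<^esub> z = tp C G \<cdot> (\<iota> \<cdot> tzero C G)"
    unfolding z_def by (rule T_elements_inv_zero) (auto simp: Hom_iff)
  have id: "Idt C ?X \<in> Hom ?X (TO C G)"
    by (simp add: Hom_iff)
  have "?t = \<langle>?t \<cdot> prj0 C G P, ?t \<cdot> prj1 C G P\<rangle>"
    by (rule pair_prj[symmetric]) auto
  then have "?t \<cdot> triv_inv C G m i
      = \<langle>?t \<cdot> prj0 C G P, ?t \<cdot> prj1 C G P\<rangle> \<cdot> ((tzero C G \<otimes> i) \<cdot> Tm)"
    by (simp add: triv_inv_def Tm_def)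
  also have "\<dots> = \<langle>z, \<langle>tp C G \<cdot> (\<iota> \<cdot> tzero C G), Idt C ?X\<rangle> \<cdot> Tm\<rangle> \<cdot> Tm"
    by (simp add: z_def)
  also have "\<dots> = Idt C ?X"
    using E.inv_solve_left[of "\<langle>tp C G \<cdot> (\<iota> \<cdot> tzero C G), Idt C ?X\<rangle> \<cdot> Tm" z "Idt C ?X"] z id iz
    by (simp add: elements_def Hom_iff)
  finally show ?thesis .
qed

lemma comp_triv_prj1:
  assumes "x \<in> Hom X (TO C G)"
  shows "x \<cdot> (triv C G m \<iota> P i \<cdot> (prj1 C G P \<cdot> i))
    = \<langle>x \<cdot> (tp C G \<cdot> (\<iota> \<cdot> tzero C G)), x\<rangle> \<cdot> Tm"
  using assms by (simp add: Hom_iff)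

text \<open>
  For the projections \<open>g\<close> and \<open>v\<close> of \<open>G \<times> P\<close> and \<open>z = g0\<close>, the base point of \<open>z \<bullet> v\<close> is \<open>g\<close>,
  and what remains is the cancellation \<open>z\<^sup>- \<bullet> (z \<bullet> v) = v\<close>.
\<close>

lemma triv_inv_triv: "triv_inv C G m i \<cdot> triv C G m \<iota> P i = Idt C (Prd C G P)"
proof (rule into_trivialisation_eqI)
  let ?X = "Prd C G P"
  let ?y = "triv_inv C G m i"
  interpret E: group "TG_elements ?X"
    by (rule T_elements_group) simp
  define z where "z = prj0 C G P \<cdot> tzero C G"
  define v where "v = prj1 C G P \<cdot> i"
  have zv: "z \<in> Hom ?X (TO C G)" "v \<in> Hom ?X (TO C G)"
    by (auto simp: z_def v_def Hom_iff)
  have iz: "inv\<^bsub>TG_elements ?X\<^esub> z = prj0 C G P \<cdot> (\<iota> \<cdot> tzero C G)"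
    unfolding z_def by (rule T_elements_inv_zero) (auto simp: Hom_iff)
  have y: "?y \<in> Hom ?X (TO C G)"
    by (simp add: Hom_iff)
  have yp: "?y \<cdot> (tp C G \<cdot> h) = prj0 C G P \<cdot> h" if "h \<in> Arr C" "Dom C h = G" for h
    using that comp_assoc[of ?y "tp C G" h] by (simp add: triv_inv_tp)
  have "?y \<cdot> (triv C G m \<iota> P i \<cdot> (prj1 C G P \<cdot> i)) = \<langle>inv\<^bsub>TG_elements ?X\<^esub> z, \<langle>z, v\<rangle> \<cdot> Tm\<rangle> \<cdot> Tm"
    unfolding comp_triv_prj1[OF y] iz by (simp add: yp) (simp add: triv_inv_eq z_def v_def)
  also have "\<dots> = v"
    using E.inv_solve_left[of v z "\<langle>z, v\<rangle> \<cdot> Tm"] zv by (simp add: elements_def Hom_iff)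
  finally show "(?y \<cdot> triv C G m \<iota> P i) \<cdot> (prj1 C G P \<cdot> i) = Idt C ?X \<cdot> (prj1 C G P \<cdot> i)"
    by (simp add: v_def)
qed (auto simp: Hom_iff triv_inv_tp)

text \<open>
  With \<open>y = z \<bullet> v\<close> as before, the fibre component of the left side is \<open>(z\<^sup>-)\<^sup>- \<bullet> y\<^sup>-\<close>, which is
  the inverse of the conjugate \<open>y \<bullet> z\<^sup>-\<close>.  Keeping \<open>z\<close> as a double inverse brings it into the form of
  the rule for the inverse of a product.
\<close>

lemma triv_inv_T_inv_triv:
  "triv_inv C G m i \<cdot> TA C \<iota> \<cdot> triv C G m \<iota> P i
     = \<langle>prj0 C G P \<cdot> \<iota>, Ad_left C G m \<iota> P i \<cdot> T_inv_fibre C \<iota> P i\<rangle>"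
proof (rule into_trivialisation_eqI)
  let ?X = "Prd C G P"
  let ?y = "triv_inv C G m i"
  let ?x = "?y \<cdot> TA C \<iota>"
  interpret E: group "TG_elements ?X"
    by (rule T_elements_group) simp
  define z where "z = prj0 C G P \<cdot> tzero C G"
  have z: "z \<in> Hom ?X (TO C G)"
    by (simp add: z_def Hom_iff)
  have iz: "inv\<^bsub>TG_elements ?X\<^esub> z = prj0 C G P \<cdot> (\<iota> \<cdot> tzero C G)"
    unfolding z_def by (rule T_elements_inv_zero) (auto simp: Hom_iff)
  have y: "?y \<in> Hom ?X (TO C G)" and x: "?x \<in> Hom ?X (TO C G)"
    by (auto simp: Hom_iff)
  have iy: "inv\<^bsub>TG_elements ?X\<^esub> ?y = ?x"
    using T_elements_inv[OF y] by simp
  have "?x \<cdot> tp C G = (?y \<cdot> tp C G) \<cdot> \<iota>"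
    using TA_tp[of \<iota>] by simp
  then have xp: "?x \<cdot> tp C G = prj0 C G P \<cdot> \<iota>"
    by (simp add: triv_inv_tp)
  then show "(?x \<cdot> triv C G m \<iota> P i) \<cdot> prj0 C G P
      = \<langle>prj0 C G P \<cdot> \<iota>, Ad_left C G m \<iota> P i \<cdot> T_inv_fibre C \<iota> P i\<rangle> \<cdot> prj0 C G P"
    by simp
  have "?x \<cdot> (tp C G \<cdot> (\<iota> \<cdot> tzero C G)) = prj0 C G P \<cdot> (\<iota> \<cdot> (\<iota> \<cdot> tzero C G))"
    using arg_cong[OF xp, of "\<lambda>h. h \<cdot> (\<iota> \<cdot> tzero C G)"] by simp
  also have "\<dots> = (prj0 C G P \<cdot> (\<iota> \<cdot> tzero C G)) \<cdot> TA C \<iota>"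
    using tzero_TA[of \<iota>] by simp
  also have "\<dots> = inv\<^bsub>TG_elements ?X\<^esub> (inv\<^bsub>TG_elements ?X\<^esub> z)"
    unfolding iz by (rule T_elements_inv[symmetric]) (auto simp: Hom_iff)
  finally have "?x \<cdot> (tp C G \<cdot> (\<iota> \<cdot> tzero C G)) = inv\<^bsub>TG_elements ?X\<^esub> (inv\<^bsub>TG_elements ?X\<^esub> z)" .
  then have "?x \<cdot> (triv C G m \<iota> P i \<cdot> (prj1 C G P \<cdot> i))
      = \<langle>inv\<^bsub>TG_elements ?X\<^esub> (inv\<^bsub>TG_elements ?X\<^esub> z), inv\<^bsub>TG_elements ?X\<^esub> ?y\<rangle> \<cdot> Tm"
    unfolding comp_triv_prj1[OF x] iy by simp
  also have "\<dots> = inv\<^bsub>TG_elements ?X\<^esub> (\<langle>?y, inv\<^bsub>TG_elements ?X\<^esub> z\<rangle> \<cdot> Tm)"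
    using E.inv_mult_group[of ?y "inv\<^bsub>TG_elements ?X\<^esub> z"] E.inv_closed[of z] y z
    by (simp add: elements_def)
  also have "\<dots> = (Ad_left C G m \<iota> P i \<cdot> i) \<cdot> TA C \<iota>"
    unfolding iz Ad_left_simps(4) by (rule T_elements_inv) (auto simp: Hom_iff)
  finally show "(?x \<cdot> triv C G m \<iota> P i) \<cdot> (prj1 C G P \<cdot> i)
      = \<langle>prj0 C G P \<cdot> \<iota>, Ad_left C G m \<iota> P i \<cdot> T_inv_fibre C \<iota> P i\<rangle> \<cdot> (prj1 C G P \<cdot> i)"
    by (simp del: Ad_left_simps(4))
qed (auto simp: Hom_iff)

end

theorem proposition5:
  fixes C :: "('o, 'a, 'z) cartesian_tangent_category_scheme" (structure)
    and G TGu :: 'o and m u \<iota> pu :: 'a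
  assumes "cartesian_tangent_category C"
    and "group_object C G m u \<iota>"
    and "is_pullback C TGu (bang C TGu) pu u (tp C G)"
  shows "triv C G m \<iota> TGu pu \<in> Hom (TO C G) (Prd C G TGu)
    \<and> inverse_arrows C (triv C G m \<iota> TGu pu) (triv_inv C G m pu)
    \<and> triv_inv C G m pu \<cdot> TA C \<iota> \<cdot> triv C G m \<iota> TGu pu
      = \<langle>prj0 C G TGu \<cdot> \<iota>, Ad_left C G m \<iota> TGu pu \<cdot> T_inv_fibre C \<iota> TGu pu\<rangle>"
proof -
  interpret tangent_group_fibre C G m u \<iota> TGu pu
    using assms
    by (simp add: tangent_group_fibre_def tangent_group_fibre_axioms_def
        tangent_group_def tangent_group_axioms_def)
  show ?thesis
    using triv_triv_inv triv_inv_triv triv_inv_T_inv_triv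
    by (auto simp: inverse_arrows_def Hom_iff)
qed

end
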